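(* Let $V, W$ be Banach spaces, let $U$ be an open subset of $V$, and let $p \in \mathbb{R}$ with $p \ge 1$ and $\alpha \in \mathbb{R}$ with $\alpha \ge 0$. For $r \in U$ and $u \in U \setminus \{r\}$ define the linear operator $\mathcal{M}_{p,\alpha}(u; r) : W \to W$ by $$\mathcal{M}_{p,\alpha}(u; r) = \frac{\mathcal{I}}{\|u - r\|_V^{p}} + \alpha\, \mathcal{I},$$ where $\mathcal{I}$ is the identity operator on $W$. Then $\mathcal{M}_{p,\alpha}$ is a deflation operator (with $Z = W$).
   Context: Definition (deflation operator). Let $V, W, Z$ be Banach spaces, let $U \subset V$ be open, and for each $r \in U$ and $u \in U\setminus\{r\}$ let $\mathcal{M}(u;r): W \to Z$ be an invertible linear operator (a linear bijection). The family $\mathcal{M}$ is called a deflation operator if for every $r \in U$ and every Fréchet differentiable operator $\mathcal{F}: U \to W$ such that $\mathcal{F}(r) = 0$ and the Fréchet derivative $\mathcal{F}'(r): V \to W$ is nonsingular (i.e. an invertible bounded linear operator), one has $$\liminf_{i \to \infty} \|\mathcal{M}(u_i; r)\mathcal{F}(u_i)\|_Z > 0$$ for every sequence $(u_i)$ in $U \setminus \{r\}$ converging to $r$. *)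

theory Defs
  imports "HOL-Analysis.Analysis"
begin

definition nonsingular :: "('v::real_normed_vector \<Rightarrow> 'w::real_normed_vector) \<Rightarrow> bool" where
  "nonsingular T \<longleftrightarrow> bounded_linear T \<and> bij T"

text \<open>
  Operators on \<open>U\<close> are total functions whose values outside \<open>U\<close> are irrelevant; likewise
  \<open>M u r\<close> only matters for \<open>r \<in> U\<close> and \<open>u \<in> U - {r}\<close>.
  The limit inferior is taken in the extended reals, since the norms may be unbounded along the
  sequence.
\<close>

definition deflation_operator ::
    "'v::banach set \<Rightarrow> ('v \<Rightarrow> 'v \<Rightarrow> 'w::banach \<Rightarrow> 'z::banach) \<Rightarrow> bool" where
  "deflation_operator U M \<longleftrightarrow>
     open U \<and>
     (\<forall>r\<in>U. \<forall>u\<in>U - {r}. linear (M u r) \<and> bij (M u r)) \<and>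
     (\<forall>r\<in>U. \<forall>(F :: 'v \<Rightarrow> 'w) F'.
        F differentiable_on U \<longrightarrow> F r = 0 \<longrightarrow>
        (F has_derivative F') (at r) \<longrightarrow> nonsingular F' \<longrightarrow>
        (\<forall>u :: nat \<Rightarrow> 'v. (\<forall>i. u i \<in> U - {r}) \<longrightarrow> u \<longlonglongrightarrow> r \<longrightarrow>
           liminf (\<lambda>i. ereal (norm (M (u i) r (F (u i))))) > 0))"

definition shifted_deflation ::
    "real \<Rightarrow> real \<Rightarrow> 'v::real_normed_vector \<Rightarrow> 'v \<Rightarrow> 'w::real_normed_vector \<Rightarrow> 'w" where
  "shifted_deflation p \<alpha> u r = (\<lambda>w. (1 / norm (u - r) powr p) *\<^sub>R w + \<alpha> *\<^sub>R w)"

end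

theory Submission
  imports Defs
begin

text \<open>
  By the bounded inverse theorem (obtained here from Baire's theorem) the derivative satisfies
  \<open>norm (F' x) \<ge> c * norm x\<close> for some \<open>c > 0\<close>, hence \<open>norm (F u) \<ge> c / 2 * norm (u - r)\<close> near the
  root \<open>r\<close>. As \<open>p \<ge> 1\<close>, dividing by \<open>norm (u - r) powr p\<close> leaves at least \<open>c / 2\<close> once
  \<open>norm (u - r) < 1\<close>, and the shift by \<open>\<alpha> \<ge> 0\<close> can only increase the norm.
\<close>

text \<open>If every \<open>closure (A n)\<close> had empty interior, then by Baire's theorem so
  would their union, which is the whole space.\<close>

lemma Baire_category_banach:
  fixes A :: "nat \<Rightarrow> 'a::banach set"
  assumes "(\<Union>n. A n) = UNIV"
  obtains n a e where "e > 0" "ball a e \<subseteq> closure (A n)"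
proof -
  have "\<exists>n. interior (closure (A n)) \<noteq> {}"
  proof (rule ccontr)
    assume "\<not> ?thesis"
    then have "euclidean interior_of (\<Union>(range (\<lambda>n. closure (A n)))) = {}"
      by (intro Baire_category_alt) (auto simp: completely_metrizable_space_euclidean)
    moreover have "(\<Union>n. closure (A n)) = UNIV"
    proof -
      have "(\<Union>n. A n) \<subseteq> (\<Union>n. closure (A n))"
        by (intro UN_mono order_refl closure_subset)
      then show ?thesis by (simp add: assms top.extremum_unique)
    qed
    ultimately show False
      by simp
  qed
  then obtain n a where "a \<in> interior (closure (A n))"
    by blast
  then show ?thesis
    using that by (auto simp: mem_interior)
qed

text \<open>By surjectivity the images of the balls of integer radius cover the target, so by Baire
  one of these images is dense in some ball. Moving that ball to the origin and rescaling turns this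
  into a bound proportional to \<open>norm y\<close>. Preimages are only approximate, but
  \<open>K\<close> does not depend on the tolerance \<open>e\<close>.\<close>

lemma almost_open_bounded:
  fixes T :: "'a::real_normed_vector \<Rightarrow> 'b::banach"
  assumes "linear T" "surj T"
  obtains K where "K \<ge> 0"
    "\<And>y e. e > 0 \<Longrightarrow> \<exists>x. norm x \<le> K * norm y \<and> norm (y - T x) < e"
proof -
  interpret linear T by fact
  have "(\<Union>n. T ` cball 0 (real n)) = UNIV"
  proof -
    have "y \<in> (\<Union>n. T ` cball 0 (real n))" for y
    proof -
      obtain x where x: "y = T x" using \<open>surj T\<close> by blast
      obtain n where "norm x \<le> real n" using real_arch_simple by blast
      with x show ?thesis by (metis UN_I UNIV_I image_eqI mem_cball_0)
    qed
    then show ?thesis by blast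
  qed
  then obtain n a \<delta> where \<delta>: "\<delta> > 0" "ball a \<delta> \<subseteq> closure (T ` cball 0 (real n))"
    by (rule Baire_category_banach)
  have approx: "\<exists>x. norm x \<le> real n \<and> norm (z - T x) < e" if "norm (z - a) < \<delta>" "e > 0" for z e
  proof -
    from that \<delta> have "z \<in> closure (T ` cball 0 (real n))"
      by (auto simp: dist_norm norm_minus_commute)
    with \<open>e > 0\<close> obtain w where "w \<in> T ` cball 0 (real n)" "dist w z < e"
      by (meson closure_approachable)
    then show ?thesis
      by (auto simp: dist_norm norm_minus_commute)
  qed
  \<comment> \<open>Both \<open>a + y\<close> and \<open>a\<close> lie in the ball around
    \<open>a\<close>, so the difference of their approximate preimages serves for \<open>y\<close>.
    This doubles the radius.\<close>
  have small: "\<exists>x. norm x \<le> 2 * real n \<and> norm (y - T x) < e" if "norm y < \<delta>" "e > 0" for y e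
  proof -
    have near: "norm (a + y - a) < \<delta>" "norm (a - a) < \<delta>" "e/2 > 0"
      using that \<delta> by simp_all
    obtain x1 where 1: "norm x1 \<le> real n" "norm (a + y - T x1) < e/2"
      using approx[OF near(1,3)] by blast
    obtain x2 where 2: "norm x2 \<le> real n" "norm (a - T x2) < e/2"
      using approx[OF near(2,3)] by blast
    have eq: "y - T (x1 - x2) = (a + y - T x1) - (a - T x2)"
      by (simp add: diff)
    have "norm (y - T (x1 - x2)) < e"
      unfolding eq using 1 2 norm_triangle_ineq4[of "a + y - T x1" "a - T x2"] by linarith
    moreover have "norm (x1 - x2) \<le> 2 * real n"
      using 1 2 norm_triangle_ineq4[of x1 x2] by simp
    ultimately show ?thesis by blast
  qed
  show ?thesis
  proof
    show "0 \<le> 4 * real n / \<delta>" using \<delta> by simp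
    fix y and e :: real assume "e > 0"
    show "\<exists>x. norm x \<le> 4 * real n / \<delta> * norm y \<and> norm (y - T x) < e"
    proof (cases "y = 0")
      case True
      then show ?thesis using \<open>e > 0\<close> zero by (intro exI[of _ 0]) auto
    next
      case False
      \<comment> \<open>This factor gives \<open>s *\<^sub>R y\<close> the norm \<delta>/2, inside
        the ball. Dividing by \<open>s\<close> turns the tolerance \<open>s * e\<close> back into
        \<open>e\<close> and the radius \<open>2 * real n\<close> into the claimed bound.\<close>
      define s where "s = \<delta> / (2 * norm y)"
      have s: "s > 0" using False \<delta> by (simp add: s_def)
      have "norm (s *\<^sub>R y) < \<delta>"
        using False \<delta> by (simp add: s_def)
      with small[of "s *\<^sub>R y" "s * e"] s \<open>e > 0\<close>
      obtain x where x: "norm x \<le> 2 * real n" "norm (s *\<^sub>R y - T x) < s * e"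
        by auto
      have "s *\<^sub>R y - T x = s *\<^sub>R (y - T (x /\<^sub>R s))"
        using s by (simp add: scale scaleR_diff_right)
      then have "norm (s *\<^sub>R y - T x) = s * norm (y - T (x /\<^sub>R s))"
        using s by (metis abs_of_pos norm_scaleR)
      then have "s * norm (y - T (x /\<^sub>R s)) < s * e"
        using x(2) by linarith
      then have "norm (y - T (x /\<^sub>R s)) < e"
        using s by simp
      moreover have "norm (x /\<^sub>R s) \<le> 4 * real n / \<delta> * norm y"
        using x s False \<delta> by (simp add: s_def field_simps)
      ultimately show ?thesis by blast
    qed
  qed
qed

text \<open>Approximate preimages are corrected iteratively, halving the residual at each step.\<close>

lemma bounded_inverse:
  fixes T :: "'a::banach \<Rightarrow> 'b::banach"
  assumes T: "bounded_linear T" "bij T"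
  obtains c where "c > 0" "\<And>x. c * norm x \<le> norm (T x)"
proof -
  interpret bounded_linear T by fact
  obtain K where K: "K \<ge> 0"
    "\<And>y e. e > 0 \<Longrightarrow> \<exists>x. norm x \<le> K * norm y \<and> norm (y - T x) < e"
    using almost_open_bounded[of T] T linear_axioms bij_is_surj by blast
  have "\<exists>x. norm x \<le> K * norm y \<and> norm (y - T x) \<le> norm y / 2" for y
  proof (cases "y = 0")
    case True
    then show ?thesis using zero by (intro exI[of _ 0]) auto
  next
    case False
    then show ?thesis using K(2)[of "norm y / 2" y] by force
  qed
  then obtain g where g: "\<And>y. norm (g y) \<le> K * norm y" "\<And>y. norm (y - T (g y)) \<le> norm y / 2"
    by metis
  have bound: "norm x \<le> 2 * K * norm (T x)" for x
  proof -
    \<comment> \<open>\<open>y k\<close> is the residual of \<open>T x\<close> after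
      \<open>k\<close> corrections, and \<open>g (y k)\<close> is the next correction.\<close>
    define y where "y k = ((\<lambda>y. y - T (g y)) ^^ k) (T x)" for k
    have y0: "y 0 = T x" and ySuc: "y (Suc k) = y k - T (g (y k))" for k
      by (simp_all add: y_def)
    have ny: "norm (y k) \<le> norm (T x) * (1/2) ^ k" for k
    proof (induction k)
      case (Suc k)
      then show ?case using g(2)[of "y k"] by (simp add: ySuc)
    qed (simp add: y0)
    have ng: "norm (g (y k)) \<le> K * norm (T x) * (1/2) ^ k" for k
      using g(1)[of "y k"] mult_left_mono[OF ny K(1), of k] by (simp add: mult.assoc)
    have geo: "(\<lambda>k. K * norm (T x) * (1/2) ^ k) sums (2 * K * norm (T x))"
      using sums_mult[OF geometric_sums[of "1/2::real"], of "K * norm (T x)"]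
      by (simp add: mult_ac)
    have sn: "summable (\<lambda>k. norm (g (y k)))"
      by (rule summable_comparison_test'[OF sums_summable[OF geo]]) (use ng in simp)
    have "(\<lambda>k. T (g (y k))) sums T (\<Sum>k. g (y k))"
      using sums[OF summable_sums[OF summable_norm_cancel[OF sn]]] .
    \<comment> \<open>The terms are the differences \<open>y k - y (Suc k)\<close>, so the series
      telescopes to \<open>y 0\<close> as the residuals vanish.\<close>
    moreover have "(\<lambda>k. T (g (y k))) sums T x"
    proof -
      have "y \<longlonglongrightarrow> 0"
        by (rule Lim_null_comparison[where g = "\<lambda>k. norm (T x) * (1/2) ^ k"])
          (use ny in \<open>auto intro!: tendsto_mult_right_zero LIMSEQ_power_zero\<close>)
      from telescope_sums'[OF this] show ?thesis
        by (simp add: y0 ySuc)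
    qed
    ultimately have "T (\<Sum>k. g (y k)) = T x"
      by (rule sums_unique2)
    \<comment> \<open>Injectivity makes \<open>x\<close> itself the sum of the corrections, so the
      geometric bound on the series applies to \<open>x\<close>.\<close>
    then have "x = (\<Sum>k. g (y k))"
      using T(2) by (simp add: bij_is_inj inj_eq)
    also have "norm \<dots> \<le> (\<Sum>k. norm (g (y k)))"
      by (rule summable_norm[OF sn])
    also have "\<dots> \<le> 2 * K * norm (T x)"
      using suminf_le[OF ng sn sums_summable[OF geo]] geo by (simp add: sums_iff)
    finally show ?thesis .
  qed
  show ?thesis
  proof
    \<comment> \<open>Adding 1 keeps the denominator positive when \<open>K\<close> is 0.\<close>
    show "1 / (2 * K + 1) > 0" using K by simp
    fix x
    have "norm x \<le> (2 * K + 1) * norm (T x)"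
      using bound[of x] by (simp add: algebra_simps add_increasing)
    then show "1 / (2 * K + 1) * norm x \<le> norm (T x)"
      using K by (simp add: field_simps)
  qed
qed

text \<open>Near \<open>r\<close> the remainder of the linear approximation uses up at most half of
  the growth \<open>c * norm (x - r)\<close> of the derivative; the triangle inequality leaves the
  other half.\<close>

lemma has_derivative_norm_lower_bound:
  fixes F :: "'a::real_normed_vector \<Rightarrow> 'b::real_normed_vector"
  assumes F: "(F has_derivative F') (at r)" and c: "c > 0" "\<And>x. c * norm x \<le> norm (F' x)"
  shows "\<forall>\<^sub>F x in nhds r. c / 2 * norm (x - r) \<le> norm (F x - F r)"
proof -
  obtain d where d: "d > 0"
    "\<And>y. norm (y - r) < d \<Longrightarrow> norm (F y - F r - F' (y - r)) \<le> c / 2 * norm (y - r)"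
    using F c(1) unfolding has_derivative_at_alt by (meson half_gt_zero)
  have "c / 2 * norm (x - r) \<le> norm (F x - F r)" if "norm (x - r) < d" for x
    using d(2)[OF that] c(2)[of "x - r"] norm_triangle_sub[of "F' (x - r)" "F x - F r"]
    by (simp add: norm_minus_commute)
  then show ?thesis
    using d(1) by (auto simp: eventually_nhds_metric dist_norm)
qed

lemma shifted_deflation_scaleR:
  "shifted_deflation p \<alpha> u r w = (1 / norm (u - r) powr p + \<alpha>) *\<^sub>R w"
  by (simp add: shifted_deflation_def scaleR_add_left)

text \<open>The operator is multiplication by a scalar that is positive since \<open>u\<close>
  differs from \<open>r\<close>; the reciprocal scalar gives the inverse.\<close>

lemma shifted_deflation_linear_bij:
  fixes u r :: "'v::real_normed_vector" and p \<alpha> :: real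
  assumes "u \<noteq> r" "\<alpha> \<ge> 0"
  defines "M \<equiv> shifted_deflation p \<alpha> u r :: 'w::real_normed_vector \<Rightarrow> 'w"
  shows "linear M \<and> bij M"
proof -
  define c where "c = 1 / norm (u - r) powr p + \<alpha>"
  have "c > 0"
    unfolding c_def using assms by (intro add_pos_nonneg) auto
  moreover have "M = (*\<^sub>R) c"
    by (auto simp: M_def shifted_deflation_scaleR c_def)
  ultimately show ?thesis
    by (auto intro!: o_bij[of "(*\<^sub>R) (inverse c)"] linearI simp: fun_eq_iff algebra_simps)
qed

theorem mainTheorem2:
  fixes U :: "'v::banach set" and p \<alpha> :: real
  assumes "open U" and "p \<ge> 1" and "\<alpha> \<ge> 0"
  shows "deflation_operator U
           (shifted_deflation p \<alpha> :: 'v \<Rightarrow> 'v \<Rightarrow> 'w::banach \<Rightarrow> 'w)"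
  unfolding deflation_operator_def
proof (intro conjI ballI allI impI)
  show "open U" by fact
next
  fix r u assume "r \<in> U" "u \<in> U - {r}"
  then show "linear (shifted_deflation p \<alpha> u r :: 'w \<Rightarrow> 'w)"
    and "bij (shifted_deflation p \<alpha> u r :: 'w \<Rightarrow> 'w)"
    using shifted_deflation_linear_bij \<open>\<alpha> \<ge> 0\<close> by auto
next
  fix r and F F' :: "'v \<Rightarrow> 'w" and u :: "nat \<Rightarrow> 'v"
  assume "F r = 0" and F': "(F has_derivative F') (at r)" "nonsingular F'"
    and u: "\<forall>i. u i \<in> U - {r}" "u \<longlonglongrightarrow> r"
  obtain c where c: "c > 0" "\<And>x. c * norm x \<le> norm (F' x)"
    using F'(2) bounded_inverse unfolding nonsingular_def by blast
  have "\<forall>\<^sub>F i in sequentially. c / 2 * norm (u i - r) \<le> norm (F (u i))"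
    using eventually_compose_filterlim[OF has_derivative_norm_lower_bound[OF F'(1) c] u(2)]
    by (simp add: \<open>F r = 0\<close>)
  moreover have "\<forall>\<^sub>F i in sequentially. norm (u i - r) < 1"
    using tendstoD[OF u(2), of 1] by (simp add: dist_norm)
  ultimately have "\<forall>\<^sub>F i in sequentially.
      ereal (c / 2) \<le> ereal (norm (shifted_deflation p \<alpha> (u i) r (F (u i))))"
  proof eventually_elim
    case (elim i)
    define h where "h = norm (u i - r)"
    have h: "0 < h" "h < 1" using u(1) elim by (auto simp: h_def)
    \<comment> \<open>On (0, 1) powers decrease in the exponent, which is why the sequence was first
      restricted to distance below 1 from \<open>r\<close>.\<close>
    have "h powr p \<le> h"
      using powr_mono'[of 1 p h] h \<open>p \<ge> 1\<close> by simp
    then have "c / 2 \<le> 1 / h powr p * (c / 2 * h)"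
      using h c(1) by (simp add: field_simps)
    also have "\<dots> \<le> (1 / h powr p + \<alpha>) * norm (F (u i))"
      using elim \<open>\<alpha> \<ge> 0\<close> h c(1) by (intro mult_mono) (auto simp: h_def)
    also have "\<dots> = norm (shifted_deflation p \<alpha> (u i) r (F (u i)))"
      using \<open>\<alpha> \<ge> 0\<close> by (simp add: shifted_deflation_scaleR h_def)
    finally show ?case by simp
  qed
  \<comment> \<open>The bound \<open>c / 2\<close> is the same for all late indices, so it passes to
    the limit inferior.\<close>
  then have "ereal (c / 2) \<le> liminf (\<lambda>i. ereal (norm (shifted_deflation p \<alpha> (u i) r (F (u i)))))"
    by (rule Liminf_bounded)
  with c(1) show "liminf (\<lambda>i. ereal (norm (shifted_deflation p \<alpha> (u i) r (F (u i))))) > 0"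
    by (metis ereal_less(2) half_gt_zero less_le_trans)
qed

end
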